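(* Let $f\in C(\Omega)$ be such that $\alpha_{f,\min}^*<\alpha_{f,\max}^*$, and let $\varepsilon\in\left(0,\frac{\alpha_{f,\max}^*-\alpha_{f,\min}^*}{2}\right)$. Then there exists $\delta>0$ such that for every $g\in C(\Omega)$ with $\|f-g\|<\delta$ we have $|S_f(\alpha)-S_g(\alpha)|<\varepsilon$ for all $\alpha\in(\alpha_{f,\min}^*+\varepsilon,\ \alpha_{f,\max}^*-\varepsilon)$.
   Context: $\Omega=\{0,1\}^{\mathbb N}$ ($\mathbb N=\{1,2,\dots\}$) with the metric $d(\omega,\omega')=\sum_{k\ge1}|\omega_k-\omega'_k|2^{-k}$; $\sigma:\Omega\to\Omega$ is the one-sided shift, $(\sigma\omega)_k=\omega_{k+1}$. $C(\Omega)$ is the space of continuous functions $\Omega\to\mathbb R$ with the supremum norm $\|\cdot\|$. For $f\in C(\Omega)$ and $\alpha\in\mathbb R$, $E_f(\alpha)=\{\omega\in\Omega:\lim_{N\to\infty}\frac1N\sum_{n=1}^N f(\sigma^n\omega)=\alpha\}$. The Birkhoff spectrum is $S_f:\mathbb R\to[0,1]$, $S_f(\alpha)=\dim_H E_f(\alpha)$ (Hausdorff dimension with respect to $d$; $\dim_H\emptyset=0$). $\alpha_{f,\max}^*=\sup\{\alpha\in\mathbb R:E_f(\alpha)\ne\emptyset\}$ and $\alpha_{f,\min}^*=\inf\{\alpha\in\mathbb R:E_f(\alpha)\ne\emptyset\}$. *)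

theory Defs
  imports "HOL-Analysis.Analysis"
begin

section \<open>The space of 0-1 sequences\<close>

text \<open>
  A separate type is used because \<^typ>\<open>nat \<Rightarrow> bool\<close> already carries a (different) library metric.
  Coordinates are numbered from 0: \<open>coord x k\<close> is the coordinate $\omega_{k+1}$,
  with \<^const>\<open>True\<close> for 1 and \<^const>\<open>False\<close> for 0.
\<close>

typedef omega = "UNIV :: (nat \<Rightarrow> bool) set"
  morphisms coord Omega by simp

lemma coord_Omega [simp]: "coord (Omega u) = u"
  by (simp add: Omega_inverse)

lemma Omega_coord [simp]: "Omega (coord x) = x"
  by (rule coord_inverse)

lemma omega_eqI: "(\<And>k. coord x k = coord y k) \<Longrightarrow> x = y"
  by (simp add: fun_eq_iff flip: coord_inject)

lemma summable_omega_dist: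
  "summable (\<lambda>k. \<bar>of_bool (u k) - of_bool (v k)\<bar> / 2 ^ Suc k :: real)"
proof (rule summable_comparison_test')
  show "summable (\<lambda>k. (1/2::real) ^ Suc k)"
    by (simp add: summable_geometric)
  show "norm (\<bar>of_bool (u k) - of_bool (v k)\<bar> / 2 ^ Suc k :: real) \<le> (1/2) ^ Suc k"
    if "k \<ge> 0" for k
    by (simp add: field_simps)
qed

instantiation omega :: metric_space
begin

definition dist_omega :: "omega \<Rightarrow> omega \<Rightarrow> real" where
  "dist_omega x y = (\<Sum>k. \<bar>of_bool (coord x k) - of_bool (coord y k)\<bar> / 2 ^ Suc k)"

definition uniformity_omega :: "(omega \<times> omega) filter" where
  "uniformity_omega = (INF e\<in>{0<..}. principal {(x, y). dist x y < e})"

definition open_omega :: "omega set \<Rightarrow> bool" where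
  "open_omega U = (\<forall>x\<in>U. eventually (\<lambda>(x', y). x' = x \<longrightarrow> y \<in> U) uniformity)"

instance
proof
  show "uniformity = (INF e\<in>{0<..}. principal {(x::omega, y). dist x y < e})"
    by (rule uniformity_omega_def)
  show "open U = (\<forall>x\<in>U. \<forall>\<^sub>F (x', y) in uniformity. x' = x \<longrightarrow> y \<in> U)" for U :: "omega set"
    by (rule open_omega_def)
  show "dist x y = 0 \<longleftrightarrow> x = y" for x y :: omega
  proof
    assume "dist x y = 0"
    then have "\<forall>k. \<bar>of_bool (coord x k) - of_bool (coord y k)\<bar> / 2 ^ Suc k = (0::real)"
      unfolding dist_omega_def
      by (subst (asm) suminf_eq_zero_iff[OF summable_omega_dist]) auto
    then have "\<forall>k. coord x k = coord y k"
      by (auto simp: of_bool_def split: if_splits)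
    then show "x = y" by (blast intro: omega_eqI)
  qed (simp add: dist_omega_def)
  show "dist x y \<le> dist x z + dist y z" for x y z :: omega
    unfolding dist_omega_def suminf_add[OF summable_omega_dist summable_omega_dist]
    by (rule suminf_le[OF _ summable_omega_dist summable_add[OF summable_omega_dist summable_omega_dist]])
      (auto simp: of_bool_def)
qed

end

lemma dist_omega_cylinder:
  assumes "\<And>k. k < n \<Longrightarrow> coord x k = coord y k"
  shows "dist x y \<le> (1/2) ^ n"
proof -
  let ?t = "\<lambda>k. \<bar>of_bool (coord x k) - of_bool (coord y k)\<bar> / 2 ^ Suc k :: real"
  have "dist x y = (\<Sum>k. ?t (k + n)) + (\<Sum>k<n. ?t k)"
    unfolding dist_omega_def by (rule suminf_split_initial_segment[OF summable_omega_dist])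
  also have "(\<Sum>k<n. ?t k) = 0"
    using assms by (intro sum.neutral) auto
  also have "(\<Sum>k. ?t (k + n)) \<le> (\<Sum>k. (1/2) ^ Suc n * (1/2) ^ k)"
  proof (rule suminf_le)
    show "summable (\<lambda>k. ?t (k + n))"
      by (rule summable_ignore_initial_segment[OF summable_omega_dist])
    show "summable (\<lambda>k. (1/2) ^ Suc n * (1/2::real) ^ k)"
      by (intro summable_mult summable_geometric) simp
    show "?t (k + n) \<le> (1/2) ^ Suc n * (1/2) ^ k" for k
      by (simp add: field_simps power_add)
  qed
  also have "\<dots> = (1/2) ^ n"
    by (subst suminf_mult) (simp_all add: summable_geometric suminf_geometric)
  finally show ?thesis by simp
qed

lemma continuous_on_Omega: "continuous_on UNIV Omega"
  unfolding continuous_on_def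
proof
  fix u :: "nat \<Rightarrow> bool"
  show "(Omega \<longlongrightarrow> Omega u) (at u)"
    unfolding tendsto_iff
  proof (intro allI impI)
    fix e :: real assume "e > 0"
    then obtain n where n: "(1/2) ^ n < e"
      using real_arch_pow_inv[of e "1/2"] by auto
    define V where "V = (\<Inter>k<n. {v :: nat \<Rightarrow> bool. v k \<in> {u k}})"
    have "open V"
      unfolding V_def
    proof (intro open_INT ballI)
      fix k
      have "open ((\<lambda>v :: nat \<Rightarrow> bool. v k) -` {u k})"
        by (intro open_vimage open_discrete continuous_on_product_coordinates)
      then show "open {v :: nat \<Rightarrow> bool. v k \<in> {u k}}"
        by (simp add: vimage_def)
    qed simp
    moreover have "u \<in> V" by (simp add: V_def)
    ultimately have "\<forall>\<^sub>F v in nhds u. v \<in> V"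
      by (simp add: eventually_nhds_in_open)
    then have "\<forall>\<^sub>F v in at u. v \<in> V"
      by (simp add: eventually_at_filter eventually_mono)
    then show "\<forall>\<^sub>F v in at u. dist (Omega v) (Omega u) < e"
    proof eventually_elim
      case (elim v)
      have "dist (Omega v) (Omega u) \<le> (1/2) ^ n"
        using elim by (intro dist_omega_cylinder) (auto simp: V_def)
      with n show ?case by simp
    qed
  qed
qed

lemma compact_UNIV_omega: "compact (UNIV :: omega set)"
proof -
  have "compactin (product_topology (\<lambda>_::nat. euclidean) UNIV)
          (PiE UNIV (\<lambda>_. UNIV :: bool set))"
    by (subst compactin_PiE) (auto simp: finite_imp_compact)
  then have "compact (UNIV :: (nat \<Rightarrow> bool) set)"
    by (simp add: euclidean_product_topology)
  then have "compact (range Omega)"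
    by (rule compact_continuous_image[OF continuous_on_Omega])
  moreover have "range Omega = UNIV"
    by (metis Omega_coord surjI)
  ultimately show ?thesis by simp
qed

text \<open>
  Hence the library type \<^typ>\<open>omega \<Rightarrow>\<^sub>C real\<close> of bounded continuous functions, with its
  supremum norm, consists of all continuous real functions on \<^typ>\<open>omega\<close>.
\<close>

lemma bcontfun_omega: "(bcontfun :: (omega \<Rightarrow> real) set) = {f. continuous_on UNIV f}"
  using compact_continuous_image[OF _ compact_UNIV_omega, THEN compact_imp_bounded]
  by (auto simp: bcontfun_def)

definition shift :: "omega \<Rightarrow> omega" where
  "shift x = Omega (\<lambda>k. coord x (Suc k))"


section \<open>Hausdorff dimension\<close>

text \<open>
  The convention for \<open>s = 0\<close> is diam(U)^0 = 1 for nonempty U, so that the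
  0-dimensional measure is counting measure; \<^term>\<open>0 powr 0 = (0::real)\<close> would not give this.
\<close>

definition diam_power :: "real \<Rightarrow> 'a::metric_space set \<Rightarrow> ennreal" where
  "diam_power s U =
    (if U = {} then 0 else if s = 0 then 1 else ennreal (diameter U powr s))"

text \<open>
  Covers consist of bounded sets because \<^const>\<open>diameter\<close> has no meaning on unbounded ones;
  finite covers are included since members may be empty.
\<close>

definition hausdorff_premeasure :: "real \<Rightarrow> real \<Rightarrow> 'a::metric_space set \<Rightarrow> ennreal" where
  "hausdorff_premeasure s \<delta> A =
    (INF U \<in> {U :: nat \<Rightarrow> 'a set. A \<subseteq> (\<Union>i. U i) \<and> (\<forall>i. bounded (U i) \<and> diameter (U i) \<le> \<delta>)}.
      \<Sum>i. diam_power s (U i))"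

definition hausdorff_measure :: "real \<Rightarrow> 'a::metric_space set \<Rightarrow> ennreal" where
  "hausdorff_measure s A = (SUP \<delta>\<in>{0<..}. hausdorff_premeasure s \<delta> A)"

definition hausdorff_dim :: "'a::metric_space set \<Rightarrow> ereal" where
  "hausdorff_dim A = Inf {ereal s | s. 0 \<le> s \<and> hausdorff_measure s A = 0}"

lemma hausdorff_dim_nonneg: "0 \<le> hausdorff_dim A"
  unfolding hausdorff_dim_def by (rule Inf_greatest) auto

lemma hausdorff_dim_empty: "hausdorff_dim ({} :: 'a::metric_space set) = 0"
proof -
  have "hausdorff_premeasure 0 \<delta> ({} :: 'a set) = 0" if "\<delta> > 0" for \<delta>
  proof -
    have "hausdorff_premeasure 0 \<delta> ({} :: 'a set) \<le> (\<Sum>i::nat. diam_power 0 ({} :: 'a set))"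
      unfolding hausdorff_premeasure_def using that
      by (intro INF_lower2[where i = "\<lambda>_. {}"]) auto
    then show ?thesis by (simp add: diam_power_def)
  qed
  then have "hausdorff_measure 0 ({} :: 'a set) = 0"
    unfolding hausdorff_measure_def by (simp add: SUP_eq_iff)
  then have "hausdorff_dim ({} :: 'a set) \<le> ereal 0"
    unfolding hausdorff_dim_def by (intro Inf_lower) auto
  then show ?thesis
    using hausdorff_dim_nonneg[of "{} :: 'a set"] by (simp add: zero_ereal_def)
qed

lemma hausdorff_measure_omega_eq_0:
  fixes A :: "omega set"
  assumes "s > 1"
  shows "hausdorff_measure s A = 0"
proof -
  have "hausdorff_premeasure s \<delta> A = 0" if "\<delta> > 0" for \<delta>
  proof -
    define b where "b = (2::real) powr (1 - s)"
    have b: "0 \<le> b" "b < 1"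
      using \<open>s > 1\<close> by (simp_all add: b_def powr_less_one)
    obtain m where m: "(1/2) ^ m < \<delta>"
      using real_arch_pow_inv[OF \<open>\<delta> > 0\<close>, of "1/2"] by auto
    have le: "hausdorff_premeasure s \<delta> A \<le> ennreal (b ^ n)" if "n \<ge> m" for n
    proof -
      define C where "C i = (if i < 2 ^ n then {x. \<forall>k<n. coord x k = bit (i::nat) k} else {})" for i
      have cover: "A \<subseteq> (\<Union>i. C i)"
      proof
        fix x
        define i :: nat where "i = horner_sum of_bool 2 (map (coord x) [0..<n])"
        have "take_bit n i = i"
          by (rule bit_eqI) (auto simp: i_def bit_take_bit_iff bit_horner_sum_bit_iff)
        then have "i < 2 ^ n"
          by (simp add: take_bit_nat_eq_self_iff)
        moreover have "bit i k = coord x k" if "k < n" for k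
          using that by (simp add: i_def bit_horner_sum_bit_iff)
        ultimately have "x \<in> C i" by (simp add: C_def)
        then show "x \<in> (\<Union>i. C i)" by blast
      qed
      have diam: "diameter (C i) \<le> (1/2) ^ n" for i
        unfolding diameter_def by (auto simp: C_def intro!: cSUP_least dist_omega_cylinder)
      have bdd: "bounded (C i)" for i
        using compact_UNIV_omega bounded_subset compact_imp_bounded by blast
      have "(1/2::real) ^ n \<le> (1/2) ^ m"
        using that by (intro power_decreasing) auto
      then have "diameter (C i) \<le> \<delta>" for i
        using diam[of i] m by linarith
      then have "hausdorff_premeasure s \<delta> A \<le> (\<Sum>i. diam_power s (C i))"
        unfolding hausdorff_premeasure_def using cover bdd
        by (intro INF_lower) auto
      also have "\<dots> = (\<Sum>i<2^n. diam_power s (C i))"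
        by (rule suminf_finite) (auto simp: C_def diam_power_def)
      also have "\<dots> \<le> (\<Sum>i<(2::nat)^n. ennreal (((1/2) ^ n) powr s))"
        using diam diameter_ge_0[OF bdd] \<open>s > 1\<close>
        by (intro sum_mono) (auto simp: diam_power_def intro!: ennreal_leI powr_mono2)
      also have "\<dots> = ennreal (2 ^ n * ((1/2) ^ n) powr s)"
        by (simp add: ennreal_mult flip: ennreal_power)
      also have "2 ^ n * ((1/2::real) ^ n) powr s = b ^ n"
        by (simp add: b_def powr_diff powr_power power_divide powr_divide powr_powr
              mult.commute flip: powr_realpow)
      finally show ?thesis .
    qed
    have "(\<lambda>n. ennreal (b ^ n)) \<longlonglongrightarrow> ennreal 0"
      using b by (intro tendsto_ennrealI LIMSEQ_power_zero) auto
    then have "hausdorff_premeasure s \<delta> A \<le> ennreal 0"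
      by (rule LIMSEQ_le_const) (use le in blast)
    then show ?thesis by simp
  qed
  then show ?thesis
    unfolding hausdorff_measure_def by (simp add: SUP_eq_iff)
qed

lemma hausdorff_dim_omega_le_1: "hausdorff_dim (A :: omega set) \<le> 1"
proof (rule ereal_le_epsilon2)
  fix e :: real assume "0 < e"
  then show "hausdorff_dim A \<le> 1 + ereal e"
    unfolding hausdorff_dim_def one_ereal_def
    by (intro Inf_lower) (auto simp: hausdorff_measure_omega_eq_0)
qed


section \<open>Birkhoff spectrum\<close>

definition birkhoff_set :: "(omega \<Rightarrow>\<^sub>C real) \<Rightarrow> real \<Rightarrow> omega set" where
  "birkhoff_set f \<alpha> =
    {x. (\<lambda>N. (\<Sum>n=1..N. f ((shift ^^ n) x)) / real N) \<longlonglongrightarrow> \<alpha>}"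

text \<open>
  The dimension lies in [0,1] by \<open>hausdorff_dim_nonneg\<close> and \<open>hausdorff_dim_omega_le_1\<close>,
  so the conversion to a real number is exact.
\<close>

definition birkhoff_spectrum :: "(omega \<Rightarrow>\<^sub>C real) \<Rightarrow> real \<Rightarrow> real" where
  "birkhoff_spectrum f \<alpha> = real_of_ereal (hausdorff_dim (birkhoff_set f \<alpha>))"

definition alpha_max :: "(omega \<Rightarrow>\<^sub>C real) \<Rightarrow> real" where
  "alpha_max f = Sup {\<alpha>. birkhoff_set f \<alpha> \<noteq> {}}"

definition alpha_min :: "(omega \<Rightarrow>\<^sub>C real) \<Rightarrow> real" where
  "alpha_min f = Inf {\<alpha>. birkhoff_set f \<alpha> \<noteq> {}}"

text \<open>The supremum and infimum are those of a nonempty bounded set.\<close>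

lemma birkhoff_set_nonempty: "{\<alpha>. birkhoff_set f \<alpha> \<noteq> {}} \<noteq> {}"
proof -
  define z where "z = Omega (\<lambda>_. False)"
  have "shift z = z" by (simp add: shift_def z_def)
  then have z: "(shift ^^ n) z = z" for n by (induction n) simp_all
  have "\<forall>\<^sub>F N in sequentially. (\<Sum>n=1..N. f ((shift ^^ n) z)) / real N = f z"
    using eventually_gt_at_top[of 0] by eventually_elim (simp add: z)
  then have "z \<in> birkhoff_set f (f z)"
    by (simp add: birkhoff_set_def tendsto_eventually)
  then show ?thesis by blast
qed

lemma birkhoff_set_bounded: "bounded {\<alpha>. birkhoff_set f \<alpha> \<noteq> {}}"
proof (rule boundedI)
  fix \<alpha> assume "\<alpha> \<in> {\<alpha>. birkhoff_set f \<alpha> \<noteq> {}}"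
  then obtain x where "(\<lambda>N. (\<Sum>n=1..N. f ((shift ^^ n) x)) / real N) \<longlonglongrightarrow> \<alpha>"
    by (auto simp: birkhoff_set_def)
  then have "(\<lambda>N. norm ((\<Sum>n=1..N. f ((shift ^^ n) x)) / real N)) \<longlonglongrightarrow> norm \<alpha>"
    by (rule tendsto_norm)
  moreover have "norm ((\<Sum>n=1..N. f ((shift ^^ n) x)) / real N) \<le> norm f" for N
  proof -
    have "norm (\<Sum>n=1..N. f ((shift ^^ n) x)) \<le> (\<Sum>n=1..N. norm f)"
      by (rule sum_norm_le) (rule norm_bounded)
    then show ?thesis
      by (cases "N = 0") (simp_all add: field_simps)
  qed
  ultimately show "norm \<alpha> \<le> norm f"
    by (intro LIMSEQ_le_const2) auto
qed

end

theory Submission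
  imports Defs
begin

text \<open>
  If the level set of \<open>\<phi>\<close> at \<open>\<alpha>\<close> has dimension above \<open>h\<close>, then for arbitrarily large \<open>n\<close> at least
  \<open>2 powr (n * h)\<close> words of length \<open>n\<close> have \<open>\<phi>\<close>-average close to \<open>\<alpha>\<close>, hence also \<open>\<psi>\<close>-average close to
  \<open>\<alpha>\<close> whenever \<open>\<psi>\<close> is near \<open>\<phi>\<close>. Concatenate such free words, inserting after each a control word
  of comparatively short length \<open>m \<approx> (\<epsilon>/4) n\<close> that is a prefix of a point with average well above or well
  below \<open>\<alpha>\<close>; the choice between the two is made according to the sign of the deviation of the sum
  so far. The resulting sequences have \<open>\<psi>\<close>-average exactly \<open>\<alpha>\<close>, and they form a set of
  dimension at least \<open>n h / (n + m)\<close>. Because \<open>\<alpha>\<close> lies more than \<open>\<epsilon>\<close> inside the spectrum of \<open>f\<close>,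
  the same control points serve both \<open>f\<close> and every \<open>g\<close> close to it, so the argument applies with the
  roles of \<open>f\<close> and \<open>g\<close> exchanged.
\<close>

section \<open>Words and cylinders\<close>

definition word :: "nat \<Rightarrow> omega \<Rightarrow> bool list" where
  "word n x = map (coord x) [0..<n]"

lemma length_word [simp]: "length (word n x) = n"
  by (simp add: word_def)

lemma word_eq_iff: "word n x = word n y \<longleftrightarrow> (\<forall>k<n. coord x k = coord y k)"
  by (auto simp: word_def)

lemma coord_shift_power [simp]: "coord ((shift ^^ n) x) k = coord x (n + k)"
  by (induction n arbitrary: k) (simp_all add: shift_def)

lemma shift_power_add: "(shift ^^ n) ((shift ^^ m) x) = (shift ^^ (m + n)) x"
  by (rule omega_eqI) (simp add: add_ac)

lemma word_add: "word (m + n) x = word m x @ word n ((shift ^^ m) x)"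
  by (rule nth_equalityI) (auto simp: word_def nth_append)

lemma take_word: "m \<le> n \<Longrightarrow> take m (word n x) = word m x"
  by (simp add: word_def take_map)

lemma word_eq_mono: "word n x = word n y \<Longrightarrow> m \<le> n \<Longrightarrow> word m x = word m y"
  by (simp add: word_eq_iff)

text \<open>A representative of the cylinder of \<open>u\<close>, padded with \<open>False\<close>.
  Evaluating a Birkhoff sum at it gives a quantity that depends on the word alone, as the choice of
  control words requires.\<close>

definition word_point :: "bool list \<Rightarrow> omega" where
  "word_point u = Omega (\<lambda>k. k < length u \<and> u ! k)"

lemma word_word_point: "word (length u) (word_point u) = u"
  by (rule nth_equalityI) (auto simp: word_def word_point_def)

lemma dist_omega_ge:
  assumes "coord x k \<noteq> coord y k"
  shows "(1/2) ^ Suc k \<le> dist x y"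
proof -
  let ?t = "\<lambda>k. \<bar>of_bool (coord x k) - of_bool (coord y k)\<bar> / 2 ^ Suc k :: real"
  have "sum ?t {k} \<le> suminf ?t"
    by (rule sum_le_suminf[OF summable_omega_dist]) auto
  with assms show ?thesis
    by (simp add: dist_omega_def of_bool_def power_one_over split: if_splits)
qed

text \<open>A disagreement at one coordinate \<open>k < n\<close> alone contributes
  \<open>(1/2) ^ Suc k\<close>, which is at least \<open>(1/2) ^ n\<close>. Together with
  \<open>dist_omega_cylinder\<close> this lets balls and cylinders be exchanged.\<close>

lemma word_eq_of_dist_less:
  assumes "dist x y < (1/2) ^ n"
  shows "word n x = word n y"
  unfolding word_eq_iff
proof (intro allI impI, rule ccontr)
  fix k assume "k < n" and "coord x k \<noteq> coord y k"
  then have "(1/2::real) ^ n \<le> (1/2) ^ Suc k" "(1/2) ^ Suc k \<le> dist x y"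
    by (auto intro: power_decreasing dist_omega_ge simp del: power_Suc)
  with assms show False by linarith
qed

lemma open_word_condition: "open {x. Q (word n x)}"
  unfolding open_dist
proof safe
  fix x assume "Q (word n x)"
  then show "\<exists>e>0. \<forall>y. dist y x < e \<longrightarrow> y \<in> {x. Q (word n x)}"
    by (intro exI[of _ "(1/2) ^ n"]) (auto dest: word_eq_of_dist_less)
qed

lemma closed_word_condition: "closed {x. Q (word n x)}"
  using open_word_condition[of "\<lambda>u. \<not> Q u" n]
  by (simp add: closed_def Compl_eq)

lemma bounded_omega: "bounded (A :: omega set)"
  using compact_UNIV_omega bounded_subset compact_imp_bounded by blast


section \<open>Birkhoff sums\<close>

text \<open>Left unnormalised, so that concatenating blocks amounts to adding sums
  (\<open>bsum_add\<close>).\<close>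

definition bsum :: "(omega \<Rightarrow>\<^sub>C real) \<Rightarrow> nat \<Rightarrow> omega \<Rightarrow> real" where
  "bsum f N x = (\<Sum>n=1..N. f ((shift ^^ n) x))"

lemma bsum_add: "bsum f (M + N) x = bsum f M x + bsum f N ((shift ^^ M) x)"
  by (induction N) (simp_all add: bsum_def shift_power_add del: funpow.simps)

lemma bsum_abs_le: "\<bar>bsum f N x\<bar> \<le> N * norm f"
proof -
  have "norm (bsum f N x) \<le> (\<Sum>n=1..N. norm f)"
    unfolding bsum_def by (rule sum_norm_le) (rule norm_bounded)
  then show ?thesis by simp
qed

lemma bsum_diff_le: "\<bar>bsum f N x - bsum g N x\<bar> \<le> N * norm (f - g)"
proof -
  have "bsum f N x - bsum g N x = bsum (f - g) N x"
    by (simp add: bsum_def sum_subtractf)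
  then show ?thesis
    using bsum_abs_le[of "f - g" N x] by simp
qed

lemma birkhoff_set_iff:
  "x \<in> birkhoff_set f \<alpha> \<longleftrightarrow> (\<forall>e>0. \<exists>N0. \<forall>N\<ge>N0. \<bar>bsum f N x - N * \<alpha>\<bar> \<le> e * N)"
proof
  assume "x \<in> birkhoff_set f \<alpha>"
  then have lim: "(\<lambda>N. bsum f N x / real N) \<longlonglongrightarrow> \<alpha>"
    by (simp add: birkhoff_set_def bsum_def)
  show "\<forall>e>0. \<exists>N0. \<forall>N\<ge>N0. \<bar>bsum f N x - N * \<alpha>\<bar> \<le> e * N"
  proof safe
    fix e :: real assume "e > 0"
    with lim obtain N0 where N0: "\<And>N. N \<ge> N0 \<Longrightarrow> \<bar>bsum f N x / N - \<alpha>\<bar> < e"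
      by (force simp: lim_sequentially dist_real_def)
    have "\<bar>bsum f N x - N * \<alpha>\<bar> \<le> e * N" if "N \<ge> Suc N0" for N
    proof -
      have "bsum f N x - N * \<alpha> = N * (bsum f N x / N - \<alpha>)"
        using that by (simp add: field_simps)
      then show ?thesis
        using N0[of N] that by (simp add: abs_mult mult.commute)
    qed
    then show "\<exists>N0. \<forall>N\<ge>N0. \<bar>bsum f N x - N * \<alpha>\<bar> \<le> e * N" by blast
  qed
next
  assume *: "\<forall>e>0. \<exists>N0. \<forall>N\<ge>N0. \<bar>bsum f N x - N * \<alpha>\<bar> \<le> e * N"
  have "(\<lambda>N. bsum f N x / real N) \<longlonglongrightarrow> \<alpha>"
    unfolding lim_sequentially
  proof safe
    fix r :: real assume "r > 0"
    with * obtain N0 where N0: "\<And>N. N \<ge> N0 \<Longrightarrow> \<bar>bsum f N x - N * \<alpha>\<bar> \<le> r / 2 * N"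
      by (meson half_gt_zero)
    \<comment> \<open>\<open>Suc N0\<close> excludes \<open>N = 0\<close>, where the quotient is 0
      by convention and need not be near \<alpha>.\<close>
    have "dist (bsum f N x / N) \<alpha> < r" if "N \<ge> Suc N0" for N
    proof -
      have "bsum f N x / N - \<alpha> = (bsum f N x - N * \<alpha>) / N"
        using that by (simp add: field_simps)
      then have "\<bar>bsum f N x / N - \<alpha>\<bar> \<le> r / 2"
        using N0[of N] that by (simp add: abs_divide pos_divide_le_eq)
      with \<open>r > 0\<close> show ?thesis by (simp add: dist_real_def)
    qed
    then show "\<exists>no. \<forall>n\<ge>no. dist (bsum f n x / n) \<alpha> < r" by blast
  qed
  then show "x \<in> birkhoff_set f \<alpha>"
    by (simp add: birkhoff_set_def bsum_def)
qed

text \<open>By uniform continuity, the terms with \<open>n + k0 \<le> N\<close> differ by less than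
  \<open>e / 2\<close>, because the shifted points still share \<open>k0\<close> letters. At most
  \<open>k0\<close> terms remain, each differing by at most \<open>2 * norm f\<close>;
  \<open>N0\<close> is so large that their total is at most \<open>e / 2 * N\<close>.\<close>

lemma bsum_word_variation:
  fixes e :: real
  assumes "e > 0"
  obtains N0 where "\<And>N x y. N \<ge> N0 \<Longrightarrow> word N x = word N y \<Longrightarrow> \<bar>bsum f N x - bsum f N y\<bar> \<le> e * N"
proof -
  have "uniformly_continuous_on UNIV (apply_bcontfun f)"
    using apply_bcontfun[of f] compact_UNIV_omega
    by (intro compact_uniformly_continuous) (simp_all add: bcontfun_def)
  then obtain r where r: "r > 0" "\<And>x y. dist x y < r \<Longrightarrow> dist (f x) (f y) < e / 2"
    using assms unfolding uniformly_continuous_on_def by (metis UNIV_I half_gt_zero)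
  obtain k0 where k0: "(1/2) ^ k0 < r"
    using real_arch_pow_inv[OF r(1), of "1/2"] by auto
  obtain N0 where N0: "real N0 \<ge> 4 * k0 * norm f / e"
    using real_arch_simple by blast
  have "\<bar>bsum f N x - bsum f N y\<bar> \<le> e * N" if N: "N \<ge> N0" and w: "word N x = word N y" for N x y
  proof -
    have "norm (bsum f N x - bsum f N y) \<le> (\<Sum>n=1..N. e / 2 + (if N < n + k0 then 2 * norm f else 0))"
      unfolding bsum_def sum_subtractf[symmetric]
    proof (rule sum_norm_le)
      fix n assume n: "n \<in> {1..N}"
      show "norm (f ((shift ^^ n) x) - f ((shift ^^ n) y)) \<le> e / 2 + (if N < n + k0 then 2 * norm f else 0)"
      proof (cases "N < n + k0")
        case True
        have "norm (f ((shift ^^ n) x) - f ((shift ^^ n) y)) \<le> norm f + norm f"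
          by (intro norm_triangle_le_diff add_mono norm_bounded)
        with True assms show ?thesis by simp
      next
        case False
        with n w have "dist ((shift ^^ n) x) ((shift ^^ n) y) \<le> (1/2) ^ k0"
          by (intro dist_omega_cylinder) (auto simp: word_eq_iff)
        with k0 r(2)[of "(shift ^^ n) x" "(shift ^^ n) y"] False show ?thesis
          by (simp add: dist_real_def)
      qed
    qed
    also have "\<dots> = N * (e / 2) + card {n\<in>{1..N}. N < n + k0} * (2 * norm f)"
      by (simp add: sum.distrib flip: sum.inter_filter)
    also have "\<dots> \<le> N * (e / 2) + k0 * (2 * norm f)"
    proof -
      have "{n\<in>{1..N}. N < n + k0} \<subseteq> {Suc N - k0..N}" by auto
      from card_mono[OF _ this] have "card {n\<in>{1..N}. N < n + k0} \<le> k0" by simp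
      then show ?thesis by (intro add_left_mono mult_right_mono) auto
    qed
    also have "k0 * (2 * norm f) \<le> N * (e / 2)"
    proof -
      have "4 * k0 * norm f / e \<le> N" using N N0 by linarith
      with assms show ?thesis by (simp add: pos_divide_le_eq)
    qed
    finally show ?thesis by (simp add: mult.commute)
  qed
  then show ?thesis using that by blast
qed

section \<open>Hausdorff dimension and counting words\<close>

lemma hausdorff_dim_mono:
  fixes A B :: "'a::metric_space set"
  assumes "A \<subseteq> B"
  shows "hausdorff_dim A \<le> hausdorff_dim B"
proof -
  have "hausdorff_premeasure s d A \<le> hausdorff_premeasure s d B" for s d
    unfolding hausdorff_premeasure_def using assms by (intro INF_superset_mono) auto
  then have "hausdorff_measure s A \<le> hausdorff_measure s B" for s
    unfolding hausdorff_measure_def by (intro SUP_mono) auto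
  then have "hausdorff_measure s B = 0 \<Longrightarrow> hausdorff_measure s A = 0" for s
    by (metis le_zero_eq)
  then show ?thesis
    unfolding hausdorff_dim_def by (intro Inf_superset_mono) auto
qed

lemma finite_bool_words: "finite {w :: bool list. length w = n}"
  using finite_lists_length_eq[of "UNIV :: bool set" n] by simp

lemma sum_power_tail_le:
  fixes b :: real
  assumes "0 \<le> b" "b < 1" "finite I" "\<And>n. n \<in> I \<Longrightarrow> M \<le> n"
  shows "(\<Sum>n\<in>I. b ^ n) \<le> b ^ M / (1 - b)"
proof -
  have "inj_on (\<lambda>n. n - M) I"
    using assms(4) by (auto simp: inj_on_def dest!: eq_diff_iff[THEN iffD1, rotated 2])
  then have "(\<Sum>n\<in>I. b ^ (n - M)) = (\<Sum>k\<in>(\<lambda>n. n - M) ` I. b ^ k)"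
    by (simp add: sum.reindex)
  also have "\<dots> \<le> (\<Sum>k. b ^ k)"
    using assms by (intro sum_le_suminf) (auto simp: summable_geometric)
  also have "\<dots> = 1 / (1 - b)"
    using assms by (simp add: suminf_geometric)
  finally have "b ^ M * (\<Sum>n\<in>I. b ^ (n - M)) \<le> b ^ M * (1 / (1 - b))"
    using assms by (intro mult_left_mono) auto
  moreover have "(\<Sum>n\<in>I. b ^ n) = b ^ M * (\<Sum>n\<in>I. b ^ (n - M))"
    unfolding sum_distrib_left
    by (intro sum.cong refl) (simp add: assms(4) flip: power_add)
  ultimately show ?thesis by simp
qed

text \<open>For every \<open>M\<close>, the cylinders of all words in \<open>P n\<close> with
  \<open>n \<ge> M\<close> cover \<open>E\<close>. For \<open>s > h\<close> and large
  \<open>M\<close> their total weight is at most the geometric tail of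
  \<open>2 powr (n * (h - s))\<close> from \<open>M\<close> on, which tends to 0 with growing
  \<open>M\<close>.\<close>

lemma hausdorff_dim_le_word_count:
  fixes P :: "nat \<Rightarrow> bool list set" and h :: real
  assumes "0 \<le> h"
    and len: "\<And>n w. w \<in> P n \<Longrightarrow> length w = n"
    and card_le: "\<And>n. N0 \<le> n \<Longrightarrow> card (P n) \<le> 2 powr (n * h)"
    and cover: "\<And>x M. x \<in> E \<Longrightarrow> \<exists>n\<ge>M. word n x \<in> P n"
  shows "hausdorff_dim E \<le> ereal h"
proof -
  have null: "hausdorff_measure s E = 0" if "h < s" for s
  proof -
    define b where "b = (2::real) powr (h - s)"
    have b: "0 \<le> b" "b < 1"
      using that by (simp_all add: b_def powr_less_one)
    have "s > 0" using that \<open>0 \<le> h\<close> by simp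
    have "hausdorff_premeasure s d E = 0" if "d > 0" for d
    proof -
      obtain m where m: "(1/2) ^ m < d"
        using real_arch_pow_inv[OF \<open>d > 0\<close>, of "1/2"] by auto
      have le: "hausdorff_premeasure s d E \<le> ennreal (b ^ M / (1 - b))" if M: "M \<ge> max m N0" for M
      proof -
        define W where "W = (\<Union>n\<in>{M..}. P n)"
        define cyl where "cyl u = {x. word (length u) x = u}" for u
        \<comment> \<open>Covers are sequences: the words of \<open>W\<close> are numbered by
          \<open>to_nat\<close>, and all other indices receive the empty set, which has weight
          0.\<close>
        define U where "U i = (if i \<in> to_nat ` W then cyl (from_nat i) else {})" for i
        have UW: "U (to_nat u) = cyl u" if "u \<in> W" for u
          using that by (simp add: U_def)
        have diam: "diameter (cyl u) \<le> (1/2) ^ length u" for u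
        proof -
          have "cyl u \<noteq> {}" using word_word_point by (auto simp: cyl_def)
          moreover have "dist x y \<le> (1/2) ^ length u" if "x \<in> cyl u" "y \<in> cyl u" for x y
            using that word_eq_iff[of "length u" x y] by (intro dist_omega_cylinder) (simp add: cyl_def)
          ultimately show ?thesis unfolding diameter_def by (auto intro!: cSUP_least)
        qed
        have lenW: "M \<le> length u" if "u \<in> W" for u
          using that len by (auto simp: W_def)
        have "diameter (U i) \<le> d" for i
        proof (cases "i \<in> to_nat ` W")
          case True
          then obtain u where u: "u \<in> W" "i = to_nat u" by auto
          have "(1/2::real) ^ length u \<le> (1/2) ^ m"
            using lenW[OF u(1)] M by (intro power_decreasing) auto
          with diam[of u] m have "diameter (cyl u) \<le> d" by linarith
          with UW[OF u(1)] u(2) show ?thesis by simp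
        next
          case False
          with that \<open>d > 0\<close> show ?thesis by (simp add: U_def)
        qed
        moreover have "E \<subseteq> (\<Union>i. U i)"
        proof
          fix x assume "x \<in> E"
          then obtain n where n: "n \<ge> M" "word n x \<in> P n" using cover by blast
          then have "word n x \<in> W" by (auto simp: W_def)
          then have "x \<in> U (to_nat (word n x))" by (simp add: UW cyl_def)
          then show "x \<in> (\<Union>i. U i)" by blast
        qed
        ultimately have "hausdorff_premeasure s d E \<le> (\<Sum>i. diam_power s (U i))"
          unfolding hausdorff_premeasure_def by (intro INF_lower) (auto simp: bounded_omega)
        also have "\<dots> \<le> ennreal (b ^ M / (1 - b))"
        proof (rule suminf_le_const[OF summableI])
          fix k
          \<comment> \<open>It suffices to bound the partial sums. Each involves only a finite set
            of words, which can be sorted by length.\<close>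
          define F where "F = {u \<in> W. to_nat u < k}"
          have "finite F"
            by (rule inj_on_finite[of to_nat _ "{..<k}"]) (auto simp: F_def)
          have "(\<Sum>i<k. diam_power s (U i)) = (\<Sum>i\<in>to_nat ` F. diam_power s (U i))"
            by (rule sum.mono_neutral_right) (auto simp: F_def U_def diam_power_def)
          also have "\<dots> = (\<Sum>u\<in>F. diam_power s (U (to_nat u)))"
            by (simp add: sum.reindex)
          also have "\<dots> \<le> (\<Sum>u\<in>F. ennreal (2 powr (- s * length u)))"
          proof (rule sum_mono)
            fix u assume "u \<in> F"
            then have "U (to_nat u) = cyl u" by (simp add: F_def UW)
            moreover have "diameter (cyl u) powr s \<le> ((1/2) ^ length u) powr s"
              using diam \<open>s > 0\<close> diameter_ge_0[OF bounded_omega] by (intro powr_mono2) auto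
            moreover have "((1/2::real) ^ length u) powr s = 2 powr (- s * length u)"
              by (simp add: powr_minus powr_powr powr_divide power_one_over inverse_eq_divide
                  mult.commute flip: powr_realpow)
            ultimately show "diam_power s (U (to_nat u)) \<le> ennreal (2 powr (- s * length u))"
              using \<open>s > 0\<close> by (auto simp: diam_power_def intro: ennreal_leI)
          qed
          also have "\<dots> = ennreal (\<Sum>u\<in>F. 2 powr (- s * length u))"
            by (simp add: sum_ennreal)
          also have "(\<Sum>u\<in>F. 2 powr (- s * length u)) \<le> b ^ M / (1 - b)"
          proof -
            have "(\<Sum>u\<in>F. 2 powr (- s * length u)) =
                (\<Sum>n\<in>length ` F. \<Sum>u\<in>{u\<in>F. length u = n}. 2 powr (- s * length u))"
              by (rule sum.image_gen[OF \<open>finite F\<close>])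
            also have "\<dots> \<le> (\<Sum>n\<in>length ` F. b ^ n)"
            proof (rule sum_mono)
              fix n assume "n \<in> length ` F"
              then have n: "M \<le> n" using lenW by (auto simp: F_def)
              have "{u\<in>F. length u = n} \<subseteq> P n"
                using len by (auto simp: F_def W_def)
              then have "card {u\<in>F. length u = n} \<le> card (P n)"
                by (intro card_mono finite_subset[OF _ finite_bool_words[of n]]) (auto simp: len)
              also have "card (P n) \<le> 2 powr (n * h)"
                using n M by (intro card_le) simp
              finally have "card {u\<in>F. length u = n} * 2 powr (- s * n)
                  \<le> 2 powr (n * h) * 2 powr (- s * n)"
                by (intro mult_right_mono) auto
              also have "\<dots> = b ^ n"
                by (simp add: b_def powr_powr algebra_simps flip: powr_add powr_realpow)
              finally show "(\<Sum>u\<in>{u\<in>F. length u = n}. 2 powr (- s * length u)) \<le> b ^ n"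
                by simp
            qed
            also have "\<dots> \<le> b ^ M / (1 - b)"
              using \<open>finite F\<close> b lenW by (intro sum_power_tail_le) (auto simp: F_def)
            finally show ?thesis .
          qed
          finally show "(\<Sum>i<k. diam_power s (U i)) \<le> ennreal (b ^ M / (1 - b))"
            by (simp add: ennreal_leI)
        qed
        finally show ?thesis .
      qed
      have "(\<lambda>M. b ^ M / (1 - b)) \<longlonglongrightarrow> 0 / (1 - b)"
        using b by (intro tendsto_divide LIMSEQ_power_zero tendsto_const) auto
      then have "(\<lambda>M. ennreal (b ^ M / (1 - b))) \<longlonglongrightarrow> ennreal (0 / (1 - b))"
        by (rule tendsto_ennrealI)
      then have "hausdorff_premeasure s d E \<le> ennreal (0 / (1 - b))"
        by (rule LIMSEQ_le_const) (use le in blast)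
      then show ?thesis by simp
    qed
    then show ?thesis
      unfolding hausdorff_measure_def by (simp add: SUP_eq_iff)
  qed
  show ?thesis
  proof (rule ereal_le_epsilon2)
    fix e :: real assume "0 < e"
    then show "hausdorff_dim E \<le> ereal h + ereal e"
      unfolding hausdorff_dim_def using \<open>0 \<le> h\<close> by (intro Inf_lower) (auto intro!: null)
  qed
qed

section \<open>Sets generated by a branching rule\<close>

text \<open>The admissible blocks \<open>B u\<close> may depend on the whole prefix
  \<open>u\<close>, since the control word will be chosen from the sum along that prefix.\<close>

definition extend_words :: "(bool list \<Rightarrow> bool list set) \<Rightarrow> bool list set \<Rightarrow> bool list set" where
  "extend_words B A = (\<lambda>(u, w). u @ w) ` (SIGMA u:A. B u)"

lemma mem_extend_words: "x \<in> extend_words B A \<longleftrightarrow> (\<exists>u\<in>A. \<exists>w\<in>B u. x = u @ w)"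
  by (auto simp: extend_words_def)

definition tree_level :: "(bool list \<Rightarrow> bool list set) \<Rightarrow> nat \<Rightarrow> bool list set" where
  "tree_level B j = (extend_words B ^^ j) {[]}"

text \<open>The condition is stated block by block, which suits steering;
  \<open>tree_set_iff\<close> converts it to prefixes lying in the levels, which suits counting and
  compactness.\<close>

definition tree_set :: "nat \<Rightarrow> (bool list \<Rightarrow> bool list set) \<Rightarrow> omega set" where
  "tree_set L B = {x. \<forall>j. word L ((shift ^^ (j * L)) x) \<in> B (word (j * L) x)}"

context
  fixes B :: "bool list \<Rightarrow> bool list set" and L q :: nat
  assumes L_pos: "0 < L"
    and B_length: "\<And>u w. w \<in> B u \<Longrightarrow> length w = L"
    and B_card: "\<And>u. card (B u) = q"
begin

lemma B_finite: "finite (B u)"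
  by (rule finite_subset[OF _ finite_bool_words[of L]]) (auto simp: B_length)

lemma extend_words_length:
  "A \<subseteq> {u. length u = n} \<Longrightarrow> (extend_words B ^^ k) A \<subseteq> {u. length u = n + k * L}"
proof (induction k)
  case (Suc k)
  then show ?case by (force simp: mem_extend_words B_length)
qed simp

text \<open>The words of \<open>A\<close> share one length, so a concatenation splits uniquely and
  each extension multiplies the count by \<open>q\<close>. The root \<open>{[]}\<close> gives the
  size of a level, a root \<open>{c}\<close> the number of descendants of \<open>c\<close>.\<close>

lemma extend_words_card:
  assumes "A \<subseteq> {u. length u = n}"
  shows "card ((extend_words B ^^ k) A) = q ^ k * card A"
proof (induction k)
  case (Suc k)
  let ?A = "(extend_words B ^^ k) A"
  have len: "?A \<subseteq> {u. length u = n + k * L}"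
    by (rule extend_words_length[OF assms])
  then have "finite ?A"
    using finite_bool_words finite_subset by blast
  moreover have "inj_on (\<lambda>(u, w). u @ w) (SIGMA u:?A. B u)"
  proof (rule inj_onI, clarify)
    fix u w u' w' assume u: "u \<in> ?A" "u' \<in> ?A" and eq: "u @ w = u' @ w'"
    have "length u = length u'" using subsetD[OF len u(1)] subsetD[OF len u(2)] by simp
    with eq show "u = u' \<and> w = w'" by simp
  qed
  ultimately have "card (extend_words B ?A) = q * card ?A"
    by (simp add: extend_words_def card_image B_card B_finite)
  then show ?case using Suc by simp
qed simp

lemma extend_words_take:
  assumes "A \<subseteq> {u. length u = n}" "u \<in> (extend_words B ^^ k) A"
  shows "take n u \<in> A \<and> u \<in> (extend_words B ^^ k) {take n u}"
  using assms(2)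
proof (induction k arbitrary: u)
  case 0
  with assms(1) show ?case by auto
next
  case (Suc k)
  then obtain v w where v: "v \<in> (extend_words B ^^ k) A" and w: "w \<in> B v" "u = v @ w"
    by (auto simp: mem_extend_words)
  have "length v = n + k * L" using extend_words_length[OF assms(1)] v by blast
  then have "take n u = take n v" using w by simp
  with Suc.IH[OF v] w show ?case
    by (auto simp: mem_extend_words)
qed

lemma tree_level_length: "tree_level B j \<subseteq> {u. length u = j * L}"
  unfolding tree_level_def using extend_words_length[of "{[]}" 0 j] by simp

lemma tree_level_add: "tree_level B (k + j) = (extend_words B ^^ k) (tree_level B j)"
  by (simp add: tree_level_def funpow_add)

lemma tree_level_card: "card (tree_level B j) = q ^ j"
  unfolding tree_level_def using extend_words_card[of "{[]}" 0 j] by simp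

text \<open>If \<open>c\<close> is not in \<open>tree_level B j\<close> there are no descendants at
  all, hence only an inequality. For \<open>q > 0\<close>, division by \<open>q ^ J\<close> says
  that the uniform measure of a cylinder of level \<open>j\<close> is at most
  \<open>1 / q ^ j\<close>.\<close>

lemma tree_level_card_descendants:
  assumes "j \<le> J"
  shows "card {u \<in> tree_level B J. take (j * L) u = c} \<le> q ^ (J - j)"
proof (cases "length c = j * L")
  case True
  have "tree_level B J = (extend_words B ^^ (J - j)) (tree_level B j)"
    using tree_level_add[of "J - j" j] assms by simp
  then have "{u \<in> tree_level B J. take (j * L) u = c} \<subseteq> (extend_words B ^^ (J - j)) {c}"
    using extend_words_take[OF tree_level_length] by auto
  moreover have "finite ((extend_words B ^^ (J - j)) {c})"
    using extend_words_length[of "{c}" "j * L"] True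
    by (intro finite_subset[OF _ finite_bool_words]) auto
  ultimately have "card {u \<in> tree_level B J. take (j * L) u = c} \<le> card ((extend_words B ^^ (J - j)) {c})"
    by (intro card_mono)
  also have "\<dots> = q ^ (J - j)"
    using extend_words_card[of "{c}" "j * L"] True by simp
  finally show ?thesis .
next
  case False
  moreover have "length (take (j * L) u) = j * L" if "u \<in> tree_level B J" for u
    using tree_level_length[of J] that assms by auto
  ultimately have "{u \<in> tree_level B J. take (j * L) u = c} = {}" by blast
  then show ?thesis by (metis card.empty le0)
qed

lemma tree_set_iff: "x \<in> tree_set L B \<longleftrightarrow> (\<forall>j. word (j * L) x \<in> tree_level B j)"
proof
  assume x: "x \<in> tree_set L B"
  show "\<forall>j. word (j * L) x \<in> tree_level B j"
  proof
    fix j show "word (j * L) x \<in> tree_level B j"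
    proof (induction j)
      case (Suc j)
      have "word (Suc j * L) x = word (j * L) x @ word L ((shift ^^ (j * L)) x)"
        by (simp add: add.commute flip: word_add)
      moreover have "word L ((shift ^^ (j * L)) x) \<in> B (word (j * L) x)"
        using x by (simp add: tree_set_def)
      ultimately show ?case
        using Suc by (auto simp: tree_level_def mem_extend_words)
    qed (simp add: tree_level_def word_def)
  qed
next
  assume *: "\<forall>j. word (j * L) x \<in> tree_level B j"
  have "word L ((shift ^^ (j * L)) x) \<in> B (word (j * L) x)" for j
  proof -
    have "word (Suc j * L) x \<in> tree_level B (Suc j)" using * by blast
    then obtain v w where vw: "v \<in> tree_level B j" "w \<in> B v" "word (Suc j * L) x = v @ w"
      by (auto simp: tree_level_def mem_extend_words)
    moreover have "word (Suc j * L) x = word (j * L) x @ word L ((shift ^^ (j * L)) x)"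
      by (simp add: add.commute flip: word_add)
    moreover have "length v = j * L" using vw tree_level_length by blast
    ultimately show ?thesis by simp
  qed
  then show "x \<in> tree_set L B" by (simp add: tree_set_def)
qed

text \<open>No branch dies when \<open>q > 0\<close>: blocks are chosen one after another, and the
  limit is a point of the tree set. Consequently a cover of the tree set accounts for every word of
  every finite level.\<close>

lemma tree_level_extends:
  assumes "q > 0" "u \<in> tree_level B J"
  shows "\<exists>x\<in>tree_set L B. word (J * L) x = u"
proof -
  define next_word where "next_word v = v @ (SOME w. w \<in> B v)" for v
  define e where "e i = (next_word ^^ i) u" for i
  have B_some: "(SOME w. w \<in> B v) \<in> B v" for v
    using B_card[of v] \<open>q > 0\<close> by (metis card.empty ex_in_conv not_gr_zero someI)
  have e_level: "e i \<in> tree_level B (i + J)" for i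
  proof (induction i)
    case (Suc i)
    then show ?case
      using B_some by (auto simp: e_def next_word_def tree_level_def mem_extend_words)
  qed (simp add: e_def assms)
  then have e_length: "length (e i) = (i + J) * L" for i
    using tree_level_length by blast
  have e_nth: "e (i + d) ! k = e i ! k" if "k < length (e i)" for i d k
  proof (induction d)
    case (Suc d)
    have "k < length (e (i + d))"
      using that by (simp add: e_length add_mult_distrib)
    then have "e (Suc (i + d)) ! k = e (i + d) ! k"
      by (simp add: e_def next_word_def nth_append)
    with Suc show ?case by simp
  qed simp
  \<comment> \<open>Since \<open>0 < L\<close>, the word \<open>e (Suc k)\<close> has more than
    \<open>k\<close> letters, and by \<open>e_nth\<close> its letter \<open>k\<close> is that of
    every sufficiently long \<open>e i\<close>.\<close>
  define x where "x = Omega (\<lambda>k. e (Suc k) ! k)"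
  have x_word: "word ((i + J) * L) x = e i" for i
  proof (rule nth_equalityI)
    fix k assume "k < length (word ((i + J) * L) x)"
    then have k: "k < length (e i)" by (simp add: e_length)
    have "Suc k * 1 \<le> (Suc k + J) * L" using L_pos by (intro mult_le_mono) auto
    then have k': "k < length (e (Suc k))" by (simp add: e_length)
    have "e (Suc k) ! k = e i ! k"
      using e_nth[OF k, of "Suc k"] e_nth[OF k', of i] by (simp add: add.commute)
    with k show "word ((i + J) * L) x ! k = e i ! k"
      by (simp add: word_def x_def e_length)
  qed (simp add: e_length)
  have "word (j * L) x \<in> tree_level B j" for j
  proof -
    have "e j \<in> (extend_words B ^^ J) (tree_level B j)"
      using e_level[of j] by (simp add: add.commute flip: tree_level_add)
    then have "take (j * L) (e j) \<in> tree_level B j"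
      using extend_words_take[OF tree_level_length] by blast
    then show ?thesis by (simp add: take_word flip: x_word)
  qed
  moreover have "word (J * L) x = u"
    using x_word[of 0] by (simp add: e_def)
  ultimately show ?thesis using tree_set_iff by blast
qed

section \<open>Lower bound for the dimension of a tree set\<close>

lemma compact_tree_set: "compact (tree_set L B)"
proof -
  have "tree_set L B = (\<Inter>j. {x. word (j * L) x \<in> tree_level B j})"
    by (auto simp: tree_set_iff)
  moreover have "closed {x. word (j * L) x \<in> tree_level B j}" for j
    by (rule closed_word_condition)
  ultimately have "closed (tree_set L B)" by auto
  then show ?thesis
    using compact_Int_closed[OF compact_UNIV_omega] by simp
qed

text \<open>
  Finite subadditivity of the uniform measure on the tree, by counting the words of one common level.
\<close>

lemma tree_cover_weight_ge_1:
  assumes "q > 0" "finite I"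
    and cover: "\<And>x. x \<in> tree_set L B \<Longrightarrow> \<exists>i\<in>I. word (j i * L) x = c i"
  shows "1 \<le> (\<Sum>i\<in>I. 1 / real q ^ j i)"
proof -
  \<comment> \<open>A common upper bound of the \<open>j i\<close>; unlike a maximum, the sum is
    also defined for empty \<open>I\<close>.\<close>
  define J where "J = (\<Sum>i\<in>I. j i)"
  have le_J: "j i \<le> J" if "i \<in> I" for i
    unfolding J_def using that \<open>finite I\<close> by (intro member_le_sum) auto
  let ?D = "\<lambda>i. {u \<in> tree_level B J. take (j i * L) u = c i}"
  have "tree_level B J \<subseteq> (\<Union>i\<in>I. ?D i)"
  proof
    fix u assume u: "u \<in> tree_level B J"
    then obtain x where x: "x \<in> tree_set L B" "word (J * L) x = u"
      using tree_level_extends[OF \<open>q > 0\<close>] by blast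
    then obtain i where i: "i \<in> I" "word (j i * L) x = c i" using cover by blast
    then have "take (j i * L) u = c i"
      using x take_word[of "j i * L" "J * L" x] le_J[OF i(1)] by simp
    with u i show "u \<in> (\<Union>i\<in>I. ?D i)" by blast
  qed
  moreover have finite_level: "finite (tree_level B J)"
    by (rule finite_subset[OF tree_level_length finite_bool_words])
  ultimately have "card (tree_level B J) \<le> card (\<Union>i\<in>I. ?D i)"
    using \<open>finite I\<close> by (intro card_mono) auto
  also have "\<dots> \<le> (\<Sum>i\<in>I. card (?D i))"
    by (rule card_UN_le[OF \<open>finite I\<close>])
  also have "\<dots> \<le> (\<Sum>i\<in>I. q ^ (J - j i))"
    by (intro sum_mono tree_level_card_descendants le_J)
  finally have "real (q ^ J) \<le> real (\<Sum>i\<in>I. q ^ (J - j i))"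
    unfolding tree_level_card of_nat_le_iff .
  also have "\<dots> = (\<Sum>i\<in>I. real q ^ J * (1 / real q ^ j i))"
    unfolding of_nat_sum of_nat_power
    by (intro sum.cong refl) (use \<open>q > 0\<close> le_J in \<open>simp add: power_diff\<close>)
  also have "\<dots> = real q ^ J * (\<Sum>i\<in>I. 1 / real q ^ j i)"
    by (simp add: sum_distrib_left)
  finally show ?thesis using \<open>q > 0\<close> by simp
qed

text \<open>This is the estimate "mass at most a constant times diameter to the power
  \<open>s\<close>". In \<open>C\<close>, the exponent \<open>s * L\<close> pays for rounding a word
  length down to a multiple of \<open>L\<close>, and a further \<open>s\<close> for rounding the
  diameter to a power of 1/2. The term \<eta> serves sets of weight 0, since every cylinder of the
  tree has positive mass.\<close>

lemma small_set_in_tree_cylinder: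
  fixes U :: "omega set" and s \<eta> :: real
  assumes "0 \<le> s" "2 powr (s * L) \<le> q" "2 \<le> q" "diameter U \<le> 1/2" "0 < \<eta>"
  defines "C \<equiv> 2 powr (s * (L + 1))"
  shows "\<exists>j. (\<forall>x\<in>U. \<forall>y\<in>U. word (j * L) x = word (j * L) y) \<and>
    1 / real q ^ j \<le> C * enn2real (diam_power s U) + \<eta>"
proof -
  have dist_le: "dist x y \<le> diameter U" if "x \<in> U" "y \<in> U" for x y
    using that by (rule diameter_bounded_bound[OF bounded_omega])
  have "0 \<le> diameter U" by (rule diameter_ge_0[OF bounded_omega])
  then consider "U \<noteq> {}" "diameter U = 0" "s = 0" | "U = {} \<or> diameter U = 0 \<and> 0 < s"
    | "U \<noteq> {}" "0 < diameter U"
    using \<open>0 \<le> s\<close> by force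
  then show ?thesis
  proof cases
    \<comment> \<open>For \<open>s = 0\<close> a nonempty set has weight 1 and \<open>C = 1\<close>,
      so the root \<open>j = 0\<close> suffices.\<close>
    case 1
    then show ?thesis
      using \<open>0 < \<eta>\<close> by (intro exI[of _ 0]) (simp add: C_def diam_power_def word_def)
  next
    \<comment> \<open>The weight is 0, but \<open>U\<close> has at most one point and so lies in
      cylinders of every depth; one of mass below \<eta> is taken.\<close>
    case 2
    have "1 / real q < 1" using \<open>2 \<le> q\<close> by simp
    then obtain j where j: "(1 / real q) ^ j < \<eta>"
      using real_arch_pow_inv[OF \<open>0 < \<eta>\<close>] by blast
    have "0 \<le> C * enn2real (diam_power s U)" by (simp add: C_def)
    with j have "1 / real q ^ j \<le> C * enn2real (diam_power s U) + \<eta>"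
      by (simp add: power_one_over)
    moreover have "x = y" if "x \<in> U" "y \<in> U" for x y
      using 2 dist_le[OF that] that by auto
    ultimately show ?thesis by blast
  next
    case 3
    \<comment> \<open>The dyadic scale with
      \<open>(1/2) ^ Suc m \<le> diameter U < (1/2) ^ m\<close>: the upper bound makes the points of
      \<open>U\<close> share \<open>m\<close> letters, the lower one compares the mass with the
      diameter. For \<open>m = 0\<close> the upper bound comes from
      \<open>diameter U \<le> 1/2\<close>.\<close>
    define m where "m = (LEAST m. (1/2::real) ^ Suc m \<le> diameter U)"
    obtain k where k: "(1/2::real) ^ k < diameter U"
      using real_arch_pow_inv[OF 3(2), of "1/2"] by auto
    have "(1/2::real) ^ Suc k \<le> (1/2) ^ k" by (intro power_decreasing) auto
    with k have "(1/2::real) ^ Suc k \<le> diameter U" by linarith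
    then have m1: "(1/2) ^ Suc m \<le> diameter U" unfolding m_def by (rule LeastI)
    have m2: "diameter U < (1/2) ^ m"
    proof (cases m)
      case 0
      with \<open>diameter U \<le> 1/2\<close> show ?thesis by simp
    next
      case (Suc m')
      then have "\<not> (1/2) ^ Suc m' \<le> diameter U"
        unfolding m_def by (intro not_less_Least) simp
      with Suc show ?thesis by simp
    qed
    define j where "j = m div L"
    have "word (j * L) x = word (j * L) y" if "x \<in> U" "y \<in> U" for x y
    proof (rule word_eq_mono)
      show "word m x = word m y"
        using dist_le[OF that] m2 by (intro word_eq_of_dist_less) linarith
      show "j * L \<le> m" by (simp add: j_def)
    qed
    moreover have "1 / real q ^ j \<le> C * enn2real (diam_power s U) + \<eta>"
    proof -
      have "m < j * L + L"
        using L_pos dividend_less_div_times[of L m] by (simp add: j_def add.commute)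
      then have "real m \<le> real (j * L + L)" by linarith
      then have mL: "real m - L \<le> j * L" by simp
      have "2 powr (s * L * j) = (2 powr (s * L)) ^ j"
        by (simp add: powr_powr flip: powr_realpow)
      also have "\<dots> \<le> real q ^ j"
        using assms by (intro power_mono) auto
      finally have "1 / real q ^ j \<le> 1 / 2 powr (s * L * j)"
        by (intro divide_left_mono) (use \<open>2 \<le> q\<close> in auto)
      also have "\<dots> = 2 powr (- (s * (j * L)))"
        by (simp add: powr_minus divide_inverse mult_ac)
      also have "\<dots> \<le> 2 powr (- (s * (real m - L)))"
        using mL \<open>0 \<le> s\<close> by (intro powr_mono) (auto intro: mult_left_mono)
      also have "\<dots> = C * 2 powr (- (s * Suc m))"
        by (simp add: C_def algebra_simps flip: powr_add)
      also have "2 powr (- (s * Suc m)) = ((1/2) ^ Suc m) powr s"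
        by (simp add: powr_minus powr_powr powr_divide power_one_over inverse_eq_divide
              mult.commute flip: powr_realpow del: power_Suc of_nat_Suc)
      also have "C * ((1/2) ^ Suc m) powr s \<le> C * diameter U powr s"
        using m1 \<open>0 \<le> s\<close> by (intro mult_left_mono powr_mono2) (auto simp: C_def)
      also have "diameter U powr s = enn2real (diam_power s U)"
        using 3 by (simp add: diam_power_def)
      finally show ?thesis using \<open>0 < \<eta>\<close> by simp
    qed
    ultimately show ?thesis by blast
  qed
qed

text \<open>Mass distribution principle: each covering set is enlarged to a cylinder of comparable
  mass. Cylinders are open, so compactness leaves finitely many, and their masses sum to at least
  1.\<close>

lemma hausdorff_measure_tree_set:
  fixes s :: real
  assumes "0 \<le> s" "2 powr (s * L) \<le> q" "2 \<le> q"
  shows "hausdorff_measure s (tree_set L B) \<noteq> 0"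
proof -
  define C where "C = 2 powr (s * (L + 1))"
  have "C > 0" by (simp add: C_def)
  \<comment> \<open>The errors \<open>(1/2) ^ (i + 2)\<close> will sum to at most 1/2, so
    \<open>C\<close> times the total weight is at least 1/2.\<close>
  have "ennreal (1 / (2 * C)) \<le> hausdorff_premeasure s (1/2) (tree_set L B)"
    unfolding hausdorff_premeasure_def
  proof (rule INF_greatest, clarify)
    fix U :: "nat \<Rightarrow> omega set"
    assume cover: "tree_set L B \<subseteq> (\<Union>i. U i)"
      and small: "\<forall>i. bounded (U i) \<and> diameter (U i) \<le> 1/2"
    have "\<forall>i. \<exists>j. (\<forall>x\<in>U i. \<forall>y\<in>U i. word (j * L) x = word (j * L) y) \<and>
        1 / real q ^ j \<le> C * enn2real (diam_power s (U i)) + (1/2) ^ (i + 2)"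
      unfolding C_def using small assms
      by (intro allI small_set_in_tree_cylinder) auto
    from choice[OF this] obtain j where *: "\<forall>i. (\<forall>x\<in>U i. \<forall>y\<in>U i. word (j i * L) x = word (j i * L) y) \<and>
        1 / real q ^ j i \<le> C * enn2real (diam_power s (U i)) + (1/2) ^ (i + 2)" ..
    then have j: "1 / real q ^ j i \<le> C * enn2real (diam_power s (U i)) + (1/2) ^ (i + 2)" for i
      by simp
    \<comment> \<open>For an empty \<open>U i\<close> this is an arbitrary word, and the inclusion
      in \<open>V i\<close> is trivial.\<close>
    define c where "c i = word (j i * L) (SOME x. x \<in> U i)" for i
    define V where "V i = {x. word (j i * L) x = c i}" for i
    have "U i \<subseteq> V i" for i
    proof
      fix x assume "x \<in> U i"
      then have "(SOME x. x \<in> U i) \<in> U i" by (rule someI)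
      with \<open>x \<in> U i\<close> have "word (j i * L) x = word (j i * L) (SOME x. x \<in> U i)"
        using spec[OF *, of i] by blast
      then show "x \<in> V i" by (simp only: V_def c_def mem_Collect_eq)
    qed
    then have "tree_set L B \<subseteq> (\<Union>i\<in>UNIV. V i)"
      by (intro subset_trans[OF cover] UN_mono) auto
    moreover have "open (V i)" for i
      unfolding V_def by (rule open_word_condition)
    ultimately obtain I where I: "finite I" "tree_set L B \<subseteq> (\<Union>i\<in>I. V i)"
      using compactE_image[OF compact_tree_set, of UNIV V] by metis
    have "1 \<le> (\<Sum>i\<in>I. 1 / real q ^ j i)"
      using I assms by (intro tree_cover_weight_ge_1[where c = c]) (auto simp: V_def)
    also have "\<dots> \<le> (\<Sum>i\<in>I. C * enn2real (diam_power s (U i)) + (1/2) ^ (i + 2))"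
      by (intro sum_mono j)
    also have "\<dots> = C * (\<Sum>i\<in>I. enn2real (diam_power s (U i))) + (\<Sum>i\<in>I. (1/2) ^ i) / 4"
      by (simp add: sum.distrib sum_distrib_left sum_divide_distrib power_add)
    also have "(\<Sum>i\<in>I. (1/2::real) ^ i) \<le> (1/2) ^ 0 / (1 - 1/2)"
      using I by (intro sum_power_tail_le) auto
    finally have "1 / (2 * C) \<le> (\<Sum>i\<in>I. enn2real (diam_power s (U i)))"
      using \<open>C > 0\<close> by (simp add: field_simps)
    then have "ennreal (1 / (2 * C)) \<le> (\<Sum>i\<in>I. ennreal (enn2real (diam_power s (U i))))"
      by (subst sum_ennreal) (auto intro: ennreal_leI)
    also have "\<dots> = (\<Sum>i\<in>I. diam_power s (U i))"
      by (intro sum.cong refl) (simp add: diam_power_def)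
    also have "\<dots> \<le> (\<Sum>i. diam_power s (U i))"
      using I by (intro sum_le_suminf summableI) auto
    finally show "ennreal (1 / (2 * C)) \<le> (\<Sum>i. diam_power s (U i))" .
  qed
  also have "\<dots> \<le> hausdorff_measure s (tree_set L B)"
    unfolding hausdorff_measure_def by (intro SUP_upper) auto
  finally show ?thesis
    using \<open>C > 0\<close> by (auto simp: ennreal_eq_0_iff)
qed

lemma hausdorff_dim_tree_set:
  assumes "q > 0"
  shows "ereal (log 2 q / L) \<le> hausdorff_dim (tree_set L B)"
  unfolding hausdorff_dim_def
proof (rule Inf_greatest, safe)
  fix s :: real
  assume s: "0 \<le> s" "hausdorff_measure s (tree_set L B) = 0"
  have "log 2 q / L \<le> s"
  proof (rule ccontr)
    assume "\<not> log 2 q / L \<le> s"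
    then have sL: "s * L < log 2 q" using L_pos by (simp add: field_simps)
    then have "2 powr (s * L) < 2 powr log 2 q" by simp
    then have "2 powr (s * L) < q" using assms by simp
    \<comment> \<open>For \<open>q = 1\<close> the logarithm is 0 and \<open>s\<close> would be
      negative; hence \<open>q \<ge> 2\<close>, as the measure bound requires.\<close>
    moreover have "q \<noteq> 1" using sL s by (auto simp: mult_less_0_iff)
    ultimately show False
      using hausdorff_measure_tree_set s assms by force
  qed
  then show "ereal (log 2 q / L) \<le> ereal s" by simp
qed

end

section \<open>Steering a sequence to a prescribed average\<close>

text \<open>Otherwise the counts would be at most \<open>2 powr (n * h)\<close> from
  \<open>N0\<close> on. All sufficiently long prefixes of a point of the level set are counted, so
  \<open>hausdorff_dim_le_word_count\<close> would bound the dimension by \<open>h\<close>.\<close>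

lemma exists_many_words:
  assumes "ereal h < hausdorff_dim (birkhoff_set f \<alpha>)" "0 \<le> h" "0 < \<eta>"
  shows "\<exists>n\<ge>N0. 2 powr (n * h) < card {word n x | x. \<bar>bsum f n x - n * \<alpha>\<bar> \<le> \<eta> * n}"
proof (rule ccontr)
  define P where "P n = {word n x | x. \<bar>bsum f n x - n * \<alpha>\<bar> \<le> \<eta> * n}" for n
  assume "\<not> ?thesis"
  then have "card (P n) \<le> 2 powr (n * h)" if "N0 \<le> n" for n
    using that by (auto simp: P_def not_less)
  moreover have "\<exists>n\<ge>M. word n x \<in> P n" if x: "x \<in> birkhoff_set f \<alpha>" for x M
  proof -
    obtain N1 where "\<And>n. n \<ge> N1 \<Longrightarrow> \<bar>bsum f n x - n * \<alpha>\<bar> \<le> \<eta> * n"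
      using x \<open>0 < \<eta>\<close> unfolding birkhoff_set_iff by blast
    then have "word (max M N1) x \<in> P (max M N1)" unfolding P_def by force
    then show ?thesis by (meson max.cobounded1)
  qed
  moreover have "length w = n" if "w \<in> P n" for n w
    using that by (auto simp: P_def)
  ultimately have "hausdorff_dim (birkhoff_set f \<alpha>) \<le> ereal h"
    using hausdorff_dim_le_word_count[of h P N0] \<open>0 \<le> h\<close> by blast
  with assms(1) show False by simp
qed

text \<open>
  The sign test reads only a prefix of \<open>x\<close> and so errs by a sublinear amount: when the
  true deviation exceeds this error it does not grow, hence it is itself sublinear.
\<close>

lemma steered_in_birkhoff_set:
  assumes "0 < L"
    and down: "\<And>j. j * L * \<alpha> < bsum f (j * L) (word_point (word (j * L) x)) \<Longrightarrow>
      bsum f L ((shift ^^ (j * L)) x) \<le> L * \<alpha>"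
    and up: "\<And>j. bsum f (j * L) (word_point (word (j * L) x)) \<le> j * L * \<alpha> \<Longrightarrow>
      L * \<alpha> \<le> bsum f L ((shift ^^ (j * L)) x)"
  shows "x \<in> birkhoff_set f \<alpha>"
  unfolding birkhoff_set_iff
proof safe
  fix e :: real assume "e > 0"
  then obtain N0 where N0: "\<And>N x y. N \<ge> N0 \<Longrightarrow> word N x = word N y \<Longrightarrow>
      \<bar>bsum f N x - bsum f N y\<bar> \<le> e / 2 * N"
    using bsum_word_variation[of "e / 2" f] by auto
  define T where "T N = bsum f N x - N * \<alpha>" for N
  define c where "c = norm f + \<bar>\<alpha>\<bar>"
  have "0 \<le> c" by (simp add: c_def)
  have step: "\<bar>bsum f N y - N * \<alpha>\<bar> \<le> N * c" for N y
  proof -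
    have "\<bar>bsum f N y - N * \<alpha>\<bar> \<le> \<bar>bsum f N y\<bar> + \<bar>N * \<alpha>\<bar>" by (rule abs_triangle_ineq4)
    with bsum_abs_le[of f N y] show ?thesis by (simp add: c_def abs_mult distrib_left)
  qed
  have T_add: "T (M + N) = T M + (bsum f N ((shift ^^ M) x) - N * \<alpha>)" for M N
    by (simp add: T_def bsum_add algebra_simps)
  \<comment> \<open>While \<open>Suc j \<le> N0\<close> the trivial bound \<open>step\<close> is
    enough. Afterwards, either \<open>T\<close> is within the prefix error and one block adds at
    most \<open>L * c\<close>, or the sign test is correct and the block moves \<open>T\<close>
    towards 0, overshooting by at most \<open>L * c\<close>.\<close>
  have T_block: "\<bar>T (j * L)\<bar> \<le> e / 2 * (j * L) + (N0 + 1) * (L * c)" for j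
  proof (induction j)
    case 0
    show ?case using \<open>0 \<le> c\<close> by (simp add: T_def bsum_def)
  next
    case (Suc j)
    have eL: "0 \<le> e / 2 * L" "0 \<le> e / 2 * (j * L)" using \<open>e > 0\<close> by auto
    show ?case
    proof (cases "Suc j \<le> N0")
      case True
      then have "Suc j * (L * c) \<le> (N0 + 1) * (L * c)"
        using \<open>0 \<le> c\<close> by (intro mult_right_mono) auto
      moreover have "\<bar>T (Suc j * L)\<bar> \<le> Suc j * (L * c)"
        unfolding T_def using step[of "Suc j * L" x] by (simp only: of_nat_mult mult.assoc)
      moreover have "0 \<le> e / 2 * (Suc j * L)" using \<open>e > 0\<close> by simp
      ultimately show ?thesis by linarith
    next
      case False
      define D where "D = bsum f (j * L) (word_point (word (j * L) x)) - j * L * \<alpha>"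
      define d where "d = bsum f L ((shift ^^ (j * L)) x) - L * \<alpha>"
      have "N0 * 1 \<le> j * L" using False \<open>0 < L\<close> by (intro mult_le_mono) auto
      then have TD: "\<bar>T (j * L) - D\<bar> \<le> e / 2 * (j * L)"
        using N0[of "j * L" x "word_point (word (j * L) x)"] word_word_point[of "word (j * L) x"]
        by (simp add: T_def D_def)
      have T_Suc: "T (Suc j * L) = T (j * L) + d"
        using T_add[of "j * L" L] by (simp add: d_def add.commute)
      have d: "\<bar>d\<bar> \<le> L * c" unfolding d_def by (rule step)
      have "0 < D \<Longrightarrow> d \<le> 0" "D \<le> 0 \<Longrightarrow> 0 \<le> d"
        using down[of j] up[of j] by (auto simp: D_def d_def)
      moreover have "L * c \<le> (N0 + 1) * (L * c)"
        using \<open>0 \<le> c\<close> by (simp add: distrib_right)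
      moreover have "e / 2 * (Suc j * L) = e / 2 * (j * L) + e / 2 * L"
        by (simp add: algebra_simps add_divide_distrib)
      ultimately show ?thesis using Suc TD T_Suc d eL by linarith
    qed
  qed
  \<comment> \<open>One \<open>L * c\<close> more than in \<open>T_block\<close>, for the incomplete
    last block.\<close>
  define K where "K = (N0 + 2) * (L * c)"
  have T_le: "\<bar>T N\<bar> \<le> e / 2 * N + K" for N
  proof -
    have N: "N = N div L * L + N mod L" by simp
    have "\<bar>T N\<bar> \<le> \<bar>T (N div L * L)\<bar> + N mod L * c"
      using T_add[of "N div L * L" "N mod L"] step[of "N mod L" "(shift ^^ (N div L * L)) x"]
      unfolding N[symmetric] by linarith
    also have "\<dots> \<le> (e / 2 * (N div L * L) + (N0 + 1) * (L * c)) + L * c"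
      using \<open>0 < L\<close> \<open>0 \<le> c\<close> less_imp_le[OF mod_less_divisor[OF \<open>0 < L\<close>, of N]]
      by (intro add_mono T_block mult_right_mono) auto
    also have "e / 2 * (N div L * L) \<le> e / 2 * N"
      using \<open>e > 0\<close> by (intro mult_left_mono) (simp_all flip: of_nat_mult)
    finally show ?thesis by (simp add: K_def algebra_simps)
  qed
  obtain N1 where N1: "real N1 \<ge> 2 * K / e" using real_arch_simple by blast
  have "\<bar>bsum f N x - N * \<alpha>\<bar> \<le> e * N" if "N \<ge> N1" for N
  proof -
    have "2 * K / e \<le> N" using that N1 by linarith
    then have "K \<le> e / 2 * N" using \<open>e > 0\<close> by (simp add: field_simps)
    with T_le[of N] show ?thesis by (simp add: T_def)
  qed
  then show "\<exists>N1. \<forall>N\<ge>N1. \<bar>bsum f N x - N * \<alpha>\<bar> \<le> e * N" by blast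
qed

text \<open>A block is a free word from \<open>P\<close> followed by \<open>lo\<close> or
  \<open>hi\<close>, selected by the sign test of \<open>steered_in_birkhoff_set\<close>. The prefix
  determines the control word, so each prefix has exactly \<open>card P\<close> continuations, and
  the resulting tree set lies inside the level set.\<close>

lemma hausdorff_dim_birkhoff_set_ge:
  assumes "0 < n + m" "finite P" "P \<noteq> {}"
    and len: "\<And>w. w \<in> P \<Longrightarrow> length w = n" "length lo = m" "length hi = m"
    and lo: "\<And>w y. w \<in> P \<Longrightarrow> word (n + m) y = w @ lo \<Longrightarrow> bsum f (n + m) y \<le> real (n + m) * \<alpha>"
    and hi: "\<And>w y. w \<in> P \<Longrightarrow> word (n + m) y = w @ hi \<Longrightarrow> real (n + m) * \<alpha> \<le> bsum f (n + m) y"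
  shows "ereal (log 2 (card P) / real (n + m)) \<le> hausdorff_dim (birkhoff_set f \<alpha>)"
proof -
  define ctl where
    "ctl u = (if length u * \<alpha> < bsum f (length u) (word_point u) then lo else hi)" for u
  define B where "B u = (\<lambda>w. w @ ctl u) ` P" for u
  have "tree_set (n + m) B \<subseteq> birkhoff_set f \<alpha>"
  proof
    fix x assume x: "x \<in> tree_set (n + m) B"
    have block: "\<exists>w\<in>P. word (n + m) ((shift ^^ (j * (n + m))) x) = w @ ctl (word (j * (n + m)) x)" for j
      using x by (auto simp: tree_set_def B_def)
    show "x \<in> birkhoff_set f \<alpha>"
    proof (rule steered_in_birkhoff_set[OF \<open>0 < n + m\<close>])
      fix j
      assume "real j * real (n + m) * \<alpha> <
        bsum f (j * (n + m)) (word_point (word (j * (n + m)) x))"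
      then have "ctl (word (j * (n + m)) x) = lo" by (simp add: ctl_def)
      with block[of j] lo show "bsum f (n + m) ((shift ^^ (j * (n + m))) x) \<le> real (n + m) * \<alpha>"
        by (metis of_nat_add)
    next
      fix j
      assume "bsum f (j * (n + m)) (word_point (word (j * (n + m)) x)) \<le>
        real j * real (n + m) * \<alpha>"
      then have "ctl (word (j * (n + m)) x) = hi" by (simp add: ctl_def)
      with block[of j] hi show "real (n + m) * \<alpha> \<le> bsum f (n + m) ((shift ^^ (j * (n + m))) x)"
        by (metis of_nat_add)
    qed
  qed
  then have "hausdorff_dim (tree_set (n + m) B) \<le> hausdorff_dim (birkhoff_set f \<alpha>)"
    by (rule hausdorff_dim_mono)
  moreover have "ereal (log 2 (card P) / real (n + m)) \<le> hausdorff_dim (tree_set (n + m) B)"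
  proof (rule hausdorff_dim_tree_set[OF \<open>0 < n + m\<close>])
    show "length w = n + m" if "w \<in> B u" for u w
      using that len by (auto simp: B_def ctl_def)
    show "card (B u) = card P" for u
      unfolding B_def by (rule card_image) (simp add: inj_on_def)
    show "0 < card P" using \<open>finite P\<close> \<open>P \<noteq> {}\<close> by (simp add: card_gt_0_iff)
  qed
  ultimately show ?thesis by (auto intro: order_trans)
qed

section \<open>Transfer of dimension between nearby functions\<close>

lemma birkhoff_set_control_words:
  assumes "y0 \<in> birkhoff_set f a" "norm (f - g) \<le> d" "0 < \<eta>"
  obtains M where "\<And>m y. M \<le> m \<Longrightarrow> word m y = word m y0 \<Longrightarrow> \<bar>bsum g m y - m * a\<bar> \<le> (d + \<eta>) * m"
proof -
  obtain M1 where M1: "\<And>m. M1 \<le> m \<Longrightarrow> \<bar>bsum f m y0 - m * a\<bar> \<le> \<eta> / 2 * m"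
    using assms(1,3) unfolding birkhoff_set_iff by (meson half_gt_zero)
  obtain M2 where M2: "\<And>m x y. M2 \<le> m \<Longrightarrow> word m x = word m y \<Longrightarrow> \<bar>bsum g m x - bsum g m y\<bar> \<le> \<eta> / 2 * m"
    using bsum_word_variation[of "\<eta> / 2" g] \<open>0 < \<eta>\<close> by auto
  have "\<bar>bsum g m y - m * a\<bar> \<le> (d + \<eta>) * m" if "max M1 M2 \<le> m" "word m y = word m y0" for m y
  proof -
    have "m * norm (f - g) \<le> m * d" using assms(2) by (intro mult_left_mono) auto
    then have "\<bar>bsum f m y0 - bsum g m y0\<bar> \<le> d * m"
      using bsum_diff_le[of f m y0 g] by (simp add: mult.commute)
    \<comment> \<open>The three terms account for the change from \<open>f\<close> to
      \<open>g\<close>, the convergence at \<open>y0\<close> and the variation inside the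
      cylinder.\<close>
    moreover have "(d + \<eta>) * m = d * m + \<eta> / 2 * m + \<eta> / 2 * m" by (simp add: algebra_simps)
    ultimately show ?thesis using M1[of m] M2[of m y y0] that by linarith
  qed
  then show ?thesis using that by blast
qed

text \<open>Here \<kappa> is the margin of the control averages around \<alpha>, and \<theta> the
  relative length of control words. A free word deviates by at most \<open>3 * d * n\<close>, and
  \<open>m \<ge> \<theta> * n\<close> control letters correct at least \<open>m * \<kappa>\<close>,
  which is no less. The control letters lower the exponent by at most \<theta>, plus \<tau> for
  rounding \<open>m\<close>.\<close>

lemma hausdorff_dim_birkhoff_set_transfer:
  fixes h \<kappa> \<theta> \<tau> d :: real
  assumes close: "norm (f - g) \<le> d" "0 < d" "3 * d \<le> \<theta> * \<kappa>"
    and h: "0 \<le> h" "ereal h < hausdorff_dim (birkhoff_set f \<alpha>)"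
    and pos: "0 < \<theta>" "0 < \<tau>"
    and lo: "\<And>m y. M \<le> m \<Longrightarrow> word m y = word m y_lo \<Longrightarrow> bsum g m y \<le> m * (\<alpha> - \<kappa>)"
    and hi: "\<And>m y. M \<le> m \<Longrightarrow> word m y = word m y_hi \<Longrightarrow> m * (\<alpha> + \<kappa>) \<le> bsum g m y"
  shows "ereal (h - \<theta> - \<tau>) \<le> hausdorff_dim (birkhoff_set g \<alpha>)"
proof -
  obtain N1 where N1: "\<And>n x y. N1 \<le> n \<Longrightarrow> word n x = word n y \<Longrightarrow> \<bar>bsum g n x - bsum g n y\<bar> \<le> d * n"
    using bsum_word_variation[OF \<open>0 < d\<close>, of g] by auto
  \<comment> \<open>\<open>N2\<close> makes the control words long enough for \<open>lo\<close> and
    \<open>hi\<close>; \<open>N3\<close> makes the rounding error of \<open>m\<close> at most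
    \<open>\<tau> * n\<close>.\<close>
  obtain N2 where N2: "M / \<theta> \<le> real N2" using real_arch_simple by blast
  obtain N3 where N3: "1 / \<tau> \<le> real N3" using real_arch_simple by blast
  define P where "P n = {word n x | x. \<bar>bsum f n x - n * \<alpha>\<bar> \<le> d * n}" for n
  obtain n where n: "Suc (N1 + N2 + N3) \<le> n" "2 powr (n * h) < card (P n)"
    using exists_many_words[OF h(2,1) \<open>0 < d\<close>] unfolding P_def by blast
  define m where "m = nat \<lceil>\<theta> * n\<rceil>"
  have "0 \<le> \<theta> * n" using pos by simp
  then have m: "\<theta> * n \<le> m" "m \<le> \<theta> * n + 1"
    unfolding m_def by linarith+
  have "M / \<theta> \<le> n" using N2 n by linarith
  then have "M \<le> \<theta> * n" using pos by (simp add: field_simps)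
  with m have "M \<le> m" by linarith
  have "\<kappa> > 0"
    using close pos by (smt (verit) mult_nonneg_nonpos)
  have m\<kappa>: "3 * (d * n) \<le> m * \<kappa>"
  proof -
    have "3 * d * n \<le> \<theta> * \<kappa> * n" using close by (intro mult_right_mono) auto
    also have "\<dots> = \<theta> * n * \<kappa>" by simp
    also have "\<dots> \<le> m * \<kappa>" using m \<open>\<kappa> > 0\<close> by (intro mult_right_mono) auto
    finally show ?thesis by simp
  qed
  \<comment> \<open>One \<open>d * n\<close> each for the choice of the free word, the change from
    \<open>f\<close> to \<open>g\<close> at \<open>x\<close>, and the passage from \<open>x\<close>
    to \<open>y\<close> in the same cylinder.\<close>
  have free: "\<bar>bsum g n y - n * \<alpha>\<bar> \<le> 3 * (d * n)" if wy: "word n y \<in> P n" for y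
  proof -
    obtain x where x: "word n y = word n x" "\<bar>bsum f n x - n * \<alpha>\<bar> \<le> d * n"
      using wy unfolding P_def by auto
    have "n * norm (f - g) \<le> n * d" using close by (intro mult_left_mono) auto
    then have "\<bar>bsum f n x - bsum g n x\<bar> \<le> d * n"
      using bsum_diff_le[of f n x g] by (simp add: mult.commute)
    moreover have "\<bar>bsum g n y - bsum g n x\<bar> \<le> d * n" using n by (intro N1 x) simp
    ultimately show ?thesis using x(2) by linarith
  qed
  have split: "word n y = w \<and> word m ((shift ^^ n) y) = v"
    if "w \<in> P n" "word (n + m) y = w @ v" for w v y
    using that by (auto simp: P_def word_add)
  have "ereal (log 2 (card (P n)) / real (n + m)) \<le> hausdorff_dim (birkhoff_set g \<alpha>)"
  proof (rule hausdorff_dim_birkhoff_set_ge[where lo = "word m y_lo" and hi = "word m y_hi"])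
    show "finite (P n)"
      by (rule finite_subset[OF _ finite_bool_words[of n]]) (auto simp: P_def)
    show "P n \<noteq> {}"
    proof
      assume "P n = {}"
      with n(2) have "2 powr (n * h) < 0" by simp
      then show False by simp
    qed
  next
    fix w y assume w: "w \<in> P n" "word (n + m) y = w @ word m y_lo"
    have "bsum g m ((shift ^^ n) y) \<le> m * (\<alpha> - \<kappa>)"
      using split[OF w] \<open>M \<le> m\<close> by (intro lo) auto
    moreover have "\<bar>bsum g n y - n * \<alpha>\<bar> \<le> 3 * (d * n)"
      using split[OF w] w by (intro free) auto
    ultimately show "bsum g (n + m) y \<le> real (n + m) * \<alpha>"
      using m\<kappa> by (simp only: bsum_add of_nat_add distrib_right distrib_left right_diff_distrib)
  next
    fix w y assume w: "w \<in> P n" "word (n + m) y = w @ word m y_hi"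
    have "m * (\<alpha> + \<kappa>) \<le> bsum g m ((shift ^^ n) y)"
      using split[OF w] \<open>M \<le> m\<close> by (intro hi) auto
    moreover have "\<bar>bsum g n y - n * \<alpha>\<bar> \<le> 3 * (d * n)"
      using split[OF w] w by (intro free) auto
    ultimately show "real (n + m) * \<alpha> \<le> bsum g (n + m) y"
      using m\<kappa> by (simp only: bsum_add of_nat_add distrib_right distrib_left right_diff_distrib)
  qed (use n in \<open>auto simp: P_def\<close>)
  moreover have "h - \<theta> - \<tau> \<le> log 2 (card (P n)) / real (n + m)"
  proof -
    \<comment> \<open>Hence the \<open>m\<close> control letters take at most \<open>m\<close> away
      from \<open>(n + m) * h\<close>, which is at most \<theta> + \<tau> per letter.\<close>
    have "h \<le> 1"
      using h(2) hausdorff_dim_omega_le_1[of "birkhoff_set f \<alpha>"]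
      by (metis ereal_less_eq(3) less_imp_le one_ereal_def order_trans)
    have "0 < n" using n by simp
    have "1 / \<tau> \<le> n" using N3 n by linarith
    then have "1 \<le> \<tau> * n" using pos by (simp add: field_simps)
    have "h * m \<le> 1 * real m" using \<open>h \<le> 1\<close> by (intro mult_right_mono) auto
    also have "\<dots> \<le> (\<theta> + \<tau>) * n" using m \<open>1 \<le> \<tau> * n\<close> by (simp add: distrib_right)
    also have "\<dots> \<le> (\<theta> + \<tau>) * real (n + m)" using pos by (intro mult_left_mono) auto
    finally have "(h - \<theta> - \<tau>) * real (n + m) \<le> n * h" by (simp add: algebra_simps)
    also have "n * h = log 2 (2 powr (n * h))" by simp
    also have "\<dots> \<le> log 2 (card (P n))"
    proof -
      have "0 < 2 powr (n * h)" by simp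
      with n(2) have "0 < real (card (P n))" by linarith
      with n(2) show ?thesis by (subst log_le_cancel_iff) auto
    qed
    finally show ?thesis using \<open>0 < n\<close> by (simp add: pos_le_divide_eq)
  qed
  ultimately show ?thesis by (meson ereal_less_eq(3) order_trans)
qed

section \<open>Comparison of the spectra\<close>

lemma ereal_birkhoff_spectrum: "ereal (birkhoff_spectrum f \<alpha>) = hausdorff_dim (birkhoff_set f \<alpha>)"
proof -
  have "hausdorff_dim (birkhoff_set f \<alpha>) \<noteq> \<infinity>"
    using hausdorff_dim_omega_le_1[of "birkhoff_set f \<alpha>"] by auto
  moreover have "hausdorff_dim (birkhoff_set f \<alpha>) \<noteq> - \<infinity>"
    using hausdorff_dim_nonneg[of "birkhoff_set f \<alpha>"] by auto
  ultimately show ?thesis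
    unfolding birkhoff_spectrum_def by (cases "hausdorff_dim (birkhoff_set f \<alpha>)") auto
qed

text \<open>The function \<open>f\<close> supplies the control points, while \<phi> and \<psi> are
  compared. Keeping \<open>f\<close> separate allows both orders of the pair \<open>f\<close>,
  \<open>g\<close> with the same range of \<alpha>, without any estimate of
  \<open>alpha_max g\<close> or \<open>alpha_min g\<close>.\<close>

lemma birkhoff_spectrum_less_add:
  assumes \<alpha>: "alpha_min f + \<epsilon> < \<alpha>" "\<alpha> < alpha_max f - \<epsilon>" and "0 < \<epsilon>"
    and d: "0 < d" "d \<le> \<epsilon> / 8" "d \<le> \<epsilon> ^ 2 / 48"
    and close: "norm (\<phi> - \<psi>) \<le> d" "norm (f - \<psi>) \<le> d"
  shows "birkhoff_spectrum \<phi> \<alpha> < birkhoff_spectrum \<psi> \<alpha> + \<epsilon>"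
proof (rule ccontr)
  assume "\<not> ?thesis"
  \<comment> \<open>The assumed gap also makes
    \<open>birkhoff_spectrum \<phi> \<alpha> - \<epsilon> / 4\<close> nonnegative, as the transfer
    lemma demands of its exponent.\<close>
  then have ge: "birkhoff_spectrum \<psi> \<alpha> + \<epsilon> \<le> birkhoff_spectrum \<phi> \<alpha>" by simp
  have nonneg: "0 \<le> birkhoff_spectrum \<psi> \<alpha>"
    unfolding birkhoff_spectrum_def by (simp add: real_of_ereal_pos hausdorff_dim_nonneg)
  let ?A = "{a. birkhoff_set f a \<noteq> {}}"
  have bdd: "bdd_above ?A" "bdd_below ?A"
    using birkhoff_set_bounded by (auto intro: bounded_imp_bdd_above bounded_imp_bdd_below)
  \<comment> \<open>Control averages within \<epsilon>/2 of the extremes are more than \<epsilon>/2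
    away from \<alpha>. The control error \<open>d + \<epsilon> / 8\<close> is at most \<epsilon>/4,
    which leaves the margin \<kappa> = \<epsilon>/4.\<close>
  have "alpha_max f - \<epsilon> / 2 < Sup ?A" "Inf ?A < alpha_min f + \<epsilon> / 2"
    using \<open>0 < \<epsilon>\<close> by (simp_all add: alpha_max_def alpha_min_def)
  then obtain a_hi a_lo where a: "birkhoff_set f a_hi \<noteq> {}" "alpha_max f - \<epsilon> / 2 < a_hi"
      "birkhoff_set f a_lo \<noteq> {}" "a_lo < alpha_min f + \<epsilon> / 2"
    using less_cSup_iff[OF birkhoff_set_nonempty bdd(1)] cInf_less_iff[OF birkhoff_set_nonempty bdd(2)]
    by blast
  then obtain y_hi y_lo where y: "y_hi \<in> birkhoff_set f a_hi" "y_lo \<in> birkhoff_set f a_lo" by blast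
  have "\<epsilon> / 8 > 0" using \<open>0 < \<epsilon>\<close> by simp
  obtain M1 where M1: "\<And>m y. M1 \<le> m \<Longrightarrow> word m y = word m y_hi \<Longrightarrow>
      \<bar>bsum \<psi> m y - m * a_hi\<bar> \<le> (d + \<epsilon> / 8) * m"
    using birkhoff_set_control_words[OF y(1) close(2) \<open>\<epsilon> / 8 > 0\<close>] by blast
  obtain M2 where M2: "\<And>m y. M2 \<le> m \<Longrightarrow> word m y = word m y_lo \<Longrightarrow>
      \<bar>bsum \<psi> m y - m * a_lo\<bar> \<le> (d + \<epsilon> / 8) * m"
    using birkhoff_set_control_words[OF y(2) close(2) \<open>\<epsilon> / 8 > 0\<close>] by blast
  \<comment> \<open>One quarter puts the exponent strictly below the dimension, the others are
    \<theta> and \<tau>; the total loss stays below the gap \<epsilon> of \<open>ge\<close>.\<close>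
  have "ereal (birkhoff_spectrum \<phi> \<alpha> - \<epsilon> / 4 - \<epsilon> / 4 - \<epsilon> / 4) \<le> hausdorff_dim (birkhoff_set \<psi> \<alpha>)"
  proof (rule hausdorff_dim_birkhoff_set_transfer[OF close(1) d(1)])
    show "3 * d \<le> \<epsilon> / 4 * (\<epsilon> / 4)" using d by (simp add: power2_eq_square)
    show "0 \<le> birkhoff_spectrum \<phi> \<alpha> - \<epsilon> / 4" using ge nonneg \<open>0 < \<epsilon>\<close> by linarith
    show "ereal (birkhoff_spectrum \<phi> \<alpha> - \<epsilon> / 4) < hausdorff_dim (birkhoff_set \<phi> \<alpha>)"
      using \<open>0 < \<epsilon>\<close> by (simp flip: ereal_birkhoff_spectrum)
  next
    fix m y assume "max M1 M2 \<le> m" and w: "word m y = word m y_lo"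
    then have "bsum \<psi> m y \<le> m * (a_lo + (d + \<epsilon> / 8))"
      using M2[of m y] by (simp add: algebra_simps)
    also have "\<dots> \<le> m * (\<alpha> - \<epsilon> / 4)" using d a \<alpha> by (intro mult_left_mono) auto
    finally show "bsum \<psi> m y \<le> m * (\<alpha> - \<epsilon> / 4)" .
  next
    fix m y assume "max M1 M2 \<le> m" and w: "word m y = word m y_hi"
    have "m * (\<alpha> + \<epsilon> / 4) \<le> m * (a_hi - (d + \<epsilon> / 8))" using d a \<alpha> by (intro mult_left_mono) auto
    also have "\<dots> \<le> bsum \<psi> m y"
      using M1[of m y] w \<open>max M1 M2 \<le> m\<close> by (simp add: algebra_simps)
    finally show "m * (\<alpha> + \<epsilon> / 4) \<le> bsum \<psi> m y" .
  qed (use \<open>0 < \<epsilon>\<close> in auto)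
  with ge \<open>0 < \<epsilon>\<close> show False by (simp flip: ereal_birkhoff_spectrum)
qed

theorem theorem3p1p1:
  fixes f :: "omega \<Rightarrow>\<^sub>C real" and \<epsilon> :: real
  assumes "alpha_min f < alpha_max f"
    and "\<epsilon> \<in> {0 <..< (alpha_max f - alpha_min f) / 2}"
  shows "\<exists>\<delta>>0. \<forall>g :: omega \<Rightarrow>\<^sub>C real. norm (f - g) < \<delta> \<longrightarrow>
    (\<forall>\<alpha>\<in>{alpha_min f + \<epsilon> <..< alpha_max f - \<epsilon>}.
      \<bar>birkhoff_spectrum f \<alpha> - birkhoff_spectrum g \<alpha>\<bar> < \<epsilon>)"
proof -
  \<comment> \<open>The first bound gives \<open>d + \<epsilon> / 8 \<le> \<epsilon> / 4\<close>;
    the second is \<open>3 * d \<le> \<theta> * \<kappa>\<close> for \<theta> = \<kappa> =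
    \<epsilon>/4.\<close>
  define d where "d = min (\<epsilon> / 8) (\<epsilon> ^ 2 / 48)"
  have \<epsilon>: "0 < \<epsilon>" using assms(2) by simp
  then have d: "0 < d" "d \<le> \<epsilon> / 8" "d \<le> \<epsilon> ^ 2 / 48" by (simp_all add: d_def)
  have "\<bar>birkhoff_spectrum f \<alpha> - birkhoff_spectrum g \<alpha>\<bar> < \<epsilon>"
    if g: "norm (f - g) < d" and \<alpha>: "\<alpha> \<in> {alpha_min f + \<epsilon> <..< alpha_max f - \<epsilon>}" for g \<alpha>
  proof -
    have "birkhoff_spectrum f \<alpha> < birkhoff_spectrum g \<alpha> + \<epsilon>"
      using g \<alpha> by (intro birkhoff_spectrum_less_add[of f \<epsilon> \<alpha> d] \<epsilon> d) auto
    moreover have "birkhoff_spectrum g \<alpha> < birkhoff_spectrum f \<alpha> + \<epsilon>"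
      using g \<alpha> d(1) by (intro birkhoff_spectrum_less_add[of f \<epsilon> \<alpha> d] \<epsilon> d) (auto simp: norm_minus_commute)
    ultimately show ?thesis by linarith
  qed
  with d(1) show ?thesis by blast
qed

end
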